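(* Let $(n_k)_{k\ge0}$ be a sequence of integers, and let $$\mathcal{R}^{(n_k)}=\bigl\{\mu\in\mathcal{P}(\mathbb{T}) : \widehat{\mu}(n_k)\to1 \text{ as } k\to\infty\bigr\}.$$ Then $(n_k)_{k\ge0}$ is a rigidity sequence if and only if $\mathcal{R}^{(n_k)}$ is dense in $\mathcal{P}(\mathbb{T})$. Moreover, if this holds, then in fact $\mathcal{R}^{(n_k)}\cap\mathcal{P}_c(\mathbb{T})$ is dense in $\mathcal{P}(\mathbb{T})$.
   Context: $\mathbb{T}=\{z\in\mathbb{C}: |z|=1\}$. $\mathcal{P}(\mathbb{T})$ is the set of Borel probability measures on $\mathbb{T}$, endowed with the topology of weak convergence of measures (a compact metrizable space). $\mathcal{P}_c(\mathbb{T})$ is the set of $\mu\in\mathcal{P}(\mathbb{T})$ which are continuous, i.e. $\mu(\{z\})=0$ for every $z\in\mathbb{T}$. For $n\in\mathbb{Z}$, $\widehat{\mu}(n)=\int_{\mathbb{T}} z^n\,d\mu(z)$. A sequence of integers $(n_k)_{k\ge 0}$ is a rigidity sequence if there exists $\mu\in\mathcal{P}_c(\mathbb{T})$ such that $\widehat{\mu}(n_k)\to 1$ as $k\to\infty$. (For sequences of positive integers this is known to be equivalent to the existence of a weakly mixing measure-preserving system $(X,\mathcal{B},m;T)$ on a probability space such that $m(T^{-n_k}A\,\Delta\,A)\to 0$ for every $A\in\mathcal{B}$.) *)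

theory Defs
  imports "HOL-Probability.Probability"
begin

abbreviation unit_circle :: "complex set" where
  "unit_circle \<equiv> sphere 0 1"

definition prob_circle :: "complex measure set" where
  "prob_circle = {\<mu>. prob_space \<mu> \<and> sets \<mu> = sets (restrict_space borel unit_circle)}"

definition cont_prob_circle :: "complex measure set" where
  "cont_prob_circle = {\<mu> \<in> prob_circle. \<forall>z\<in>unit_circle. measure \<mu> {z} = 0}"

text \<open>The topology of weak convergence: the coarsest topology on \<^const>\<open>prob_circle\<close> for which
  the integral of every continuous function on the circle is a continuous function of the measure.
  Continuous functions on the (compact) circle are automatically bounded.\<close>
definition weak_topology :: "complex measure topology" where
  "weak_topology = topology_generated_by
     {{\<mu> \<in> prob_circle. (LINT z|\<mu>. f z) \<in> U} | (f :: complex \<Rightarrow> real) U.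
        continuous_on unit_circle f \<and> open U}"

lemma topspace_weak_topology [simp]: "topspace weak_topology = prob_circle"
proof -
  have "prob_circle \<in> {{\<mu> \<in> prob_circle. (LINT z|\<mu>. f z) \<in> U} | (f :: complex \<Rightarrow> real) U.
        continuous_on unit_circle f \<and> open U}"
    by (rule CollectI, rule exI[of _ "\<lambda>_. 0"], rule exI[of _ UNIV]) auto
  then show ?thesis
    unfolding weak_topology_def topology_generated_by_topspace by blast
qed

lemma limitin_weak_topology_iff:
  assumes "\<And>i. M i \<in> prob_circle" "\<mu> \<in> prob_circle"
  shows "limitin weak_topology M \<mu> F \<longleftrightarrow>
    (\<forall>f :: complex \<Rightarrow> real. continuous_on unit_circle f \<longrightarrow>
       ((\<lambda>i. LINT z|M i. f z) \<longlongrightarrow> (LINT z|\<mu>. f z)) F)"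
    (is "?L \<longleftrightarrow> ?R")
proof
  assume L: ?L
  show ?R
  proof (intro allI impI topological_tendstoI)
    fix f :: "complex \<Rightarrow> real" and U
    assume f: "continuous_on unit_circle f" and U: "open U" "(LINT z|\<mu>. f z) \<in> U"
    have "openin weak_topology {\<mu> \<in> prob_circle. (LINT z|\<mu>. f z) \<in> U}"
      unfolding weak_topology_def 
      by (rule topology_generated_by_Basis, rule CollectI, rule exI[of _ f], rule exI[of _ U])
        (use f U in simp)
    moreover have "\<mu> \<in> {\<mu> \<in> prob_circle. (LINT z|\<mu>. f z) \<in> U}"
      using U assms by simp
    ultimately have "\<forall>\<^sub>F i in F. M i \<in> {\<mu> \<in> prob_circle. (LINT z|\<mu>. f z) \<in> U}"
      using L unfolding limitin_def by metis
    then show "\<forall>\<^sub>F i in F. (LINT z|M i. f z) \<in> U"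
      by (rule eventually_mono) auto
  qed
next
  assume R: ?R
  have "\<forall>\<^sub>F i in F. M i \<in> W"
    if "generate_topology_on {{\<mu> \<in> prob_circle. (LINT z|\<mu>. f z) \<in> U} | (f :: complex \<Rightarrow> real) U.
        continuous_on unit_circle f \<and> open U} W" "\<mu> \<in> W" for W
    using that
  proof (induction rule: generate_topology_on.induct)
    case (Int a b)
    then have "\<forall>\<^sub>F i in F. M i \<in> a" "\<forall>\<^sub>F i in F. M i \<in> b" by simp_all
    then show ?case by eventually_elim simp
  next
    case (UN K)
    then obtain k where "k \<in> K" "\<mu> \<in> k" by blast
    with UN.IH have "\<forall>\<^sub>F i in F. M i \<in> k" by simp
    then show ?case by (rule eventually_mono) (use \<open>k \<in> K\<close> in blast)
  next
    case (Basis s)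
    then obtain f :: "complex \<Rightarrow> real" and U where
      s: "s = {\<mu> \<in> prob_circle. (LINT z|\<mu>. f z) \<in> U}" "continuous_on unit_circle f" "open U"
      by blast
    with Basis have "(LINT z|\<mu>. f z) \<in> U" by simp
    moreover have "((\<lambda>i. LINT z|M i. f z) \<longlongrightarrow> (LINT z|\<mu>. f z)) F"
      using R s(2) by simp
    ultimately have "\<forall>\<^sub>F i in F. (LINT z|M i. f z) \<in> U"
      using s(3) by (simp add: topological_tendstoD)
    then show ?case by (rule eventually_mono) (use s assms in simp)
  qed simp
  then show ?L
    unfolding limitin_def topspace_weak_topology
    unfolding weak_topology_def openin_topology_generated_by_iff
    using assms by simp
qed

definition fourier_coeff :: "complex measure \<Rightarrow> int \<Rightarrow> complex" where
  "fourier_coeff \<mu> n = (LINT z|\<mu>. z powi n)"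

definition rigidity_sequence :: "(nat \<Rightarrow> int) \<Rightarrow> bool" where
  "rigidity_sequence n \<longleftrightarrow>
     (\<exists>\<mu>\<in>cont_prob_circle. (\<lambda>k. fourier_coeff \<mu> (n k)) \<longlonglongrightarrow> 1)"

definition rigid_measures :: "(nat \<Rightarrow> int) \<Rightarrow> complex measure set" where
  "rigid_measures n = {\<mu> \<in> prob_circle. (\<lambda>k. fourier_coeff \<mu> (n k)) \<longlonglongrightarrow> 1}"

definition weakly_dense :: "complex measure set \<Rightarrow> bool" where
  "weakly_dense A \<longleftrightarrow> weak_topology closure_of A = prob_circle"

end

theory Submission
  imports Defs "HOL-Analysis.Kronecker_Approximation_Theorem"
begin

text \<open>
  Rigidity of \<open>\<mu>\<close> along \<open>(n\<^sub>k)\<close> means that \<open>z ^ n\<^sub>k\<close> tends to \<open>1\<close> in \<open>L\<^sup>1(\<mu>)\<close>. Hence it is inherited by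
  normalised restrictions, by images under power maps \<open>z \<mapsto> z ^ m\<close>, and by mixtures.

  If \<open>\<mu>\<close> is rigid and continuous, then \<open>\<mu>\<close>-almost every point is not a root of unity and so has a
  power close to any given \<open>w\<close>. Restricting \<open>\<mu>\<close> to a set of positive measure on which a fixed
  exponent works, and applying that power map, gives rigid continuous measures supported near \<open>w\<close>. Mixtures
  of these approximate every probability measure.

  Conversely, if rigid measures are dense, there are rigid measures supported in any prescribed arc.
  Averaging \<open>L\<close> of them, chosen successively closer to \<open>1\<close>, gives rigid measures near \<open>1\<close> whose atoms
  and whose \<open>L\<^sup>1\<close> deviations at \<open>n\<^sub>k\<close> are \<open>O(1/L)\<close>, uniformly in \<open>k\<close>. An infinite convolution of such
  measures is rigid and has no atoms.
\<close>

section \<open>Deviation of powers from 1\<close>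

abbreviation circle_borel :: "complex measure" where
  "circle_borel \<equiv> restrict_space borel unit_circle"

text \<open>Values lie in \<open>ennreal\<close> so that mixtures and infinite sums of deviations
  are handled by nonnegative integration, without integrability conditions.\<close>

definition power_deviation :: "complex measure \<Rightarrow> int \<Rightarrow> ennreal" where
  "power_deviation \<mu> m = (\<integral>\<^sup>+ z. ennreal (norm (z powi m - 1)) \<partial>\<mu>)"

text \<open>Places the circle measures in the Giry monad, where a mixture is the \<open>bind\<close>
  of a measurable kernel.\<close>

lemma prob_circle_eq: "prob_circle = space (prob_algebra circle_borel)"
  by (auto simp: prob_circle_def space_prob_algebra)

lemma prob_circleD:
  assumes "\<mu> \<in> prob_circle"
  shows "prob_space \<mu>" "sets \<mu> = sets circle_borel" "space \<mu> = unit_circle"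
  using assms sets_eq_imp_space_eq[of \<mu> circle_borel]
  by (auto simp: prob_circle_def space_restrict_space)

lemma measurable_prob_circle_iff:
  assumes "\<mu> \<in> prob_circle"
  shows "f \<in> measurable \<mu> N \<longleftrightarrow> f \<in> measurable circle_borel N"
  using prob_circleD(2)[OF assms] by (simp cong: measurable_cong_sets)

lemma norm_powi_unit_circle: "z \<in> unit_circle \<Longrightarrow> norm (z powi m) = 1"
  by (simp add: norm_power_int)

lemma continuous_on_powi_circle: "continuous_on unit_circle (\<lambda>z::complex. z powi m)"
  by (intro continuous_intros) auto

lemma measurable_powi_circle [measurable]: "(\<lambda>z. z powi m) \<in> borel_measurable circle_borel"
  by (rule borel_measurable_continuous_on_restrict[OF continuous_on_powi_circle])

lemma integrable_powi_circle:
  assumes "\<mu> \<in> prob_circle"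
  shows "integrable \<mu> (\<lambda>z. z powi m)" "integrable \<mu> (\<lambda>z. norm (z powi m - 1))"
    "integrable \<mu> (\<lambda>z. norm (z powi m - 1)^2)"
proof -
  interpret prob_space \<mu> using prob_circleD[OF assms] by simp
  note [measurable_cong] = prob_circleD(2)[OF assms]
  show "integrable \<mu> (\<lambda>z. z powi m)"
    by (rule integrable_const_bound[where B=1])
      (auto simp: prob_circleD(3)[OF assms] norm_power_int intro!: AE_I2)
  have b: "norm (z powi m - 1) \<le> 2" if "z \<in> unit_circle" for z :: complex
    using norm_triangle_ineq4[of "z powi m" 1] norm_powi_unit_circle[OF that, of m] by simp
  show "integrable \<mu> (\<lambda>z. norm (z powi m - 1))"
    by (rule integrable_const_bound[where B=2])
      (use b in \<open>auto simp: prob_circleD(3)[OF assms] intro!: AE_I2\<close>)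
  show "integrable \<mu> (\<lambda>z. norm (z powi m - 1)^2)"
    by (rule integrable_const_bound[where B="2^2"])
      (use power_mono[OF b, of _ 2] in \<open>auto simp: prob_circleD(3)[OF assms] intro!: AE_I2\<close>)
qed

lemma power_deviation_eq_LINT:
  assumes "\<mu> \<in> prob_circle"
  shows "power_deviation \<mu> m = ennreal (LINT z|\<mu>. norm (z powi m - 1))"
  unfolding power_deviation_def
  by (rule nn_integral_eq_integral) (use integrable_powi_circle[OF assms] in auto)

lemma power_deviation_le:
  assumes "\<mu> \<in> prob_circle" "AE z in \<mu>. norm (z powi m - 1) \<le> c" 
  shows "power_deviation \<mu> m \<le> ennreal c"
proof -
  interpret prob_space \<mu> using prob_circleD[OF assms(1)] by simp
  have "power_deviation \<mu> m \<le> (\<integral>\<^sup>+ z. ennreal c \<partial>\<mu>)"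
    unfolding power_deviation_def using assms(2)
    by (intro nn_integral_mono_AE) (auto elim!: eventually_mono intro: ennreal_leI)
  then show ?thesis by (simp add: emeasure_space_1)
qed

lemma power_deviation_le_2:
  assumes "\<mu> \<in> prob_circle"
  shows "power_deviation \<mu> m \<le> 2"
proof -
  have b: "norm (z powi m - 1) \<le> 2" if "z \<in> unit_circle" for z :: complex
    using norm_triangle_ineq4[of "z powi m" 1] norm_powi_unit_circle[OF that, of m] by simp
  have "AE z in \<mu>. norm (z powi m - 1) \<le> 2"
    by (rule AE_I2) (use b in \<open>simp add: prob_circleD(3)[OF assms]\<close>)
  then show ?thesis using power_deviation_le[OF assms, of m 2] by simp
qed

lemma tendsto_0_ennreal_mono:
  fixes f g :: "'a \<Rightarrow> ennreal"
  assumes "(g \<longlongrightarrow> 0) F" "\<And>x. f x \<le> g x"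
  shows "(f \<longlongrightarrow> 0) F"
  by (rule tendsto_sandwich[OF _ _ tendsto_const assms(1)]) (use assms(2) in auto)

lemma norm_diff_one_sq: "norm w = 1 \<Longrightarrow> norm (w - 1)^2 = 2 - 2 * Re w" for w :: complex
  unfolding cmod_power2 by (simp add: cmod_def power2_eq_square algebra_simps)

text \<open>Convergence of the Fourier coefficients is upgraded to convergence in mean of
  \<open>z ^ n\<^sub>k\<close> to \<open>1\<close>, because \<open>|z ^ m - 1|\<^sup>2 = 2 - 2 Re (z ^ m)\<close> on the circle.\<close>
lemma rigid_measures_iff_power_deviation:
  assumes "\<mu> \<in> prob_circle"
  shows "\<mu> \<in> rigid_measures n \<longleftrightarrow> (\<lambda>k. power_deviation \<mu> (n k)) \<longlonglongrightarrow> 0"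
proof -
  interpret prob_space \<mu> using prob_circleD[OF assms] by simp
  define d where "d m = (LINT z|\<mu>. norm (z powi m - 1))" for m
  have d0: "d m \<ge> 0" for m unfolding d_def by simp
  note int = integrable_powi_circle[OF assms]
  have up: "norm (fourier_coeff \<mu> m - 1) \<le> d m" for m
  proof -
    have "fourier_coeff \<mu> m - 1 = (LINT z|\<mu>. z powi m - 1)"
      unfolding fourier_coeff_def by (subst Bochner_Integration.integral_diff) (auto simp: int prob_space)
    also have "norm \<dots> \<le> d m" unfolding d_def by (rule integral_norm_bound)
    finally show ?thesis .
  qed
  \<comment> \<open>Nonnegativity of the variance plays the role of the Cauchy-Schwarz inequality:
    the squared mean is at most the mean of the square, and the latter is expressed by the real part
    of the Fourier coefficient.\<close>
  have low: "(d m)^2 \<le> 2 * norm (fourier_coeff \<mu> m - 1)" for m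
  proof -
    have "variance (\<lambda>z. norm (z powi m - 1)) \<ge> 0" by (rule variance_positive)
    then have "(d m)^2 \<le> (LINT z|\<mu>. norm (z powi m - 1)^2)"
      by (subst (asm) variance_eq) (auto simp: int d_def)
    also have "\<dots> = (LINT z|\<mu>. 2 - 2 * Re (z powi m))"
      by (rule Bochner_Integration.integral_cong)
        (auto simp: prob_circleD(3)[OF assms] norm_power_int norm_diff_one_sq)
    also have "\<dots> = 2 - 2 * Re (fourier_coeff \<mu> m)"
      unfolding fourier_coeff_def by (simp add: int prob_space integral_Re)
    also have "\<dots> \<le> 2 * norm (fourier_coeff \<mu> m - 1)"
      using abs_Re_le_cmod[of "fourier_coeff \<mu> m - 1"] by simp
    finally show ?thesis .
  qed
  have "(\<lambda>k. fourier_coeff \<mu> (n k)) \<longlonglongrightarrow> 1 \<longleftrightarrow> (\<lambda>k. d (n k)) \<longlonglongrightarrow> 0"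
  proof
    assume "(\<lambda>k. fourier_coeff \<mu> (n k)) \<longlonglongrightarrow> 1"
    then have "(\<lambda>k. norm (fourier_coeff \<mu> (n k) - 1)) \<longlonglongrightarrow> 0"
      by (simp add: LIM_zero tendsto_norm_zero)
    then have "(\<lambda>k. 2 * norm (fourier_coeff \<mu> (n k) - 1)) \<longlonglongrightarrow> 0"
      by (rule tendsto_mult_right_zero)
    then have "(\<lambda>k. (d (n k))^2) \<longlonglongrightarrow> 0"
      by (rule Lim_null_comparison[rotated]) (use low in auto)
    then show "(\<lambda>k. d (n k)) \<longlonglongrightarrow> 0"
      using tendsto_real_sqrt[of "\<lambda>k. (d (n k))^2" 0] d0 by simp
  next
    assume "(\<lambda>k. d (n k)) \<longlonglongrightarrow> 0"
    then have "(\<lambda>k. fourier_coeff \<mu> (n k) - 1) \<longlonglongrightarrow> 0"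
      by (rule Lim_null_comparison[rotated]) (use up in auto)
    then show "(\<lambda>k. fourier_coeff \<mu> (n k)) \<longlonglongrightarrow> 1" by (simp add: LIM_zero_iff)
  qed
  also have "\<dots> \<longleftrightarrow> (\<lambda>k. power_deviation \<mu> (n k)) \<longlonglongrightarrow> 0"
    unfolding power_deviation_eq_LINT[OF assms] d_def[symmetric]
    using d0 tendsto_ennreal_iff[of "\<lambda>k. d (n k)" sequentially 0] by simp
  finally show ?thesis using assms by (simp add: rigid_measures_def)
qed

section \<open>Atoms and normalised restrictions\<close>

lemma singleton_sets_circle: "z \<in> unit_circle \<Longrightarrow> {z} \<in> sets circle_borel"
  by (auto simp: sets_restrict_space_iff)

lemma sets_circle_pred:
  assumes "Measurable.pred borel P" shows "{z \<in> unit_circle. P z} \<in> sets circle_borel"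
proof -
  have "{z \<in> unit_circle. P z} = {z \<in> space borel. P z} \<inter> unit_circle" by auto
  then show ?thesis using assms by (auto simp: sets_restrict_space_iff)
qed

lemma cont_prob_circle_iff:
  "\<mu> \<in> cont_prob_circle \<longleftrightarrow> \<mu> \<in> prob_circle \<and> (\<forall>z\<in>unit_circle. emeasure \<mu> {z} = 0)"
proof -
  have "measure \<mu> {z} = 0 \<longleftrightarrow> emeasure \<mu> {z} = 0" if "\<mu> \<in> prob_circle" for z
  proof -
    interpret prob_space \<mu> using prob_circleD[OF that] by simp
    show ?thesis by (simp add: emeasure_eq_measure)
  qed
  then show ?thesis by (auto simp: cont_prob_circle_def)
qed

lemma uniform_measure_prob_circle:
  assumes "\<mu> \<in> prob_circle" "emeasure \<mu> B \<noteq> 0"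
  shows "uniform_measure \<mu> B \<in> prob_circle"
proof -
  interpret prob_space \<mu> using prob_circleD[OF assms(1)] by simp
  show ?thesis using assms prob_circleD[OF assms(1)]
    by (auto simp: prob_circle_def intro!: prob_space_uniform_measure)
qed

text \<open>Restriction to \<open>B\<close> enlarges deviations at most by the finite factor
  \<open>1 / emeasure \<mu> B\<close>, which does not depend on the exponent, so convergence to
  \<open>0\<close> survives.\<close>

lemma uniform_measure_rigid:
  assumes "\<mu> \<in> rigid_measures n" "emeasure \<mu> B \<noteq> 0"
  shows "uniform_measure \<mu> B \<in> rigid_measures n"
proof -
  have \<mu>: "\<mu> \<in> prob_circle" using assms by (simp add: rigid_measures_def)
  interpret prob_space \<mu> using prob_circleD[OF \<mu>] by simp
  note [measurable_cong] = prob_circleD(2)[OF \<mu>]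
  have [measurable]: "B \<in> sets \<mu>" using assms emeasure_neq_0_sets by blast
  have le: "power_deviation (uniform_measure \<mu> B) m \<le> power_deviation \<mu> m / emeasure \<mu> B" for m
    unfolding power_deviation_def
    by (subst nn_integral_uniform_measure)
      (auto intro!: divide_right_mono_ennreal nn_integral_mono split: split_indicator)
  have "(\<lambda>k. power_deviation \<mu> (n k) / emeasure \<mu> B) \<longlonglongrightarrow> 0 / emeasure \<mu> B"
    unfolding divide_ennreal_def using assms \<mu>
    by (intro tendsto_mult_ennreal tendsto_const) (auto simp: rigid_measures_iff_power_deviation)
  then have "(\<lambda>k. power_deviation (uniform_measure \<mu> B) (n k)) \<longlonglongrightarrow> 0"
    by (intro tendsto_0_ennreal_mono[OF _ le]) simp
  then show ?thesis
    by (simp add: rigid_measures_iff_power_deviation uniform_measure_prob_circle \<mu> assms)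
qed

lemma uniform_measure_continuous:
  assumes "\<mu> \<in> cont_prob_circle" "emeasure \<mu> B \<noteq> 0"
  shows "uniform_measure \<mu> B \<in> cont_prob_circle"
proof -
  have \<mu>: "\<mu> \<in> prob_circle" "\<And>z. z \<in> unit_circle \<Longrightarrow> emeasure \<mu> {z} = 0"
    using assms by (auto simp: cont_prob_circle_iff)
  have B: "B \<in> sets \<mu>" using assms emeasure_neq_0_sets by blast
  have "emeasure (uniform_measure \<mu> B) {z} = 0" if "z \<in> unit_circle" for z
  proof -
    have z: "{z} \<in> sets \<mu>" using singleton_sets_circle[OF that] prob_circleD(2)[OF \<mu>(1)] by simp
    have "emeasure \<mu> (B \<inter> {z}) \<le> emeasure \<mu> {z}" using z by (intro emeasure_mono) auto
    then show ?thesis using B z \<mu>(2)[OF that] by simp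
  qed
  then show ?thesis using uniform_measure_prob_circle[OF \<mu>(1) assms(2)] by (simp add: cont_prob_circle_iff)
qed

section \<open>Mixtures of circle measures\<close>

text \<open>The deviation integrates a fixed nonnegative function, so mixing averages it. Rigidity
  of a mixture thereby reduces to dominated convergence or, for finitely many components, to a
  finite sum of null sequences.\<close>

lemma power_deviation_bind:
  assumes "\<kappa> \<in> measurable \<sigma> (prob_algebra circle_borel)"
  shows "power_deviation (\<sigma> \<bind> \<kappa>) m = (\<integral>\<^sup>+ x. power_deviation (\<kappa> x) m \<partial>\<sigma>)"
  unfolding power_deviation_def
  by (rule nn_integral_bind[OF _ measurable_prob_algebraD[OF assms]]) measurable

lemma bind_prob_circle:
  assumes "prob_space \<sigma>" "\<kappa> \<in> measurable \<sigma> (prob_algebra circle_borel)"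
  shows "\<sigma> \<bind> \<kappa> \<in> prob_circle"
proof -
  interpret prob_space \<sigma> by fact
  have "\<And>x. x \<in> space \<sigma> \<Longrightarrow> \<kappa> x \<in> prob_circle"
    using measurable_space[OF assms(2)] by (simp add: prob_circle_eq)
  then have "prob_space (\<sigma> \<bind> \<kappa>)" "sets (\<sigma> \<bind> \<kappa>) = sets circle_borel"
    using prob_circleD not_empty
    by (auto intro!: prob_space_bind[OF _ measurable_prob_algebraD[OF assms(2)]] sets_bind)
  then show ?thesis by (simp add: prob_circle_def)
qed

lemma emeasure_bind_singleton:
  assumes "prob_space \<sigma>" "\<kappa> \<in> measurable \<sigma> (prob_algebra circle_borel)" "z \<in> unit_circle"
  shows "emeasure (\<sigma> \<bind> \<kappa>) {z} = (\<integral>\<^sup>+ x. emeasure (\<kappa> x) {z} \<partial>\<sigma>)"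
  using assms
  by (intro emeasure_bind[OF _ measurable_prob_algebraD[OF assms(2)]] singleton_sets_circle)
    (auto simp: prob_space.not_empty)

section \<open>Density of the rigid continuous measures\<close>

text \<open>One-dimensional Kronecker approximation: for irrational \<open>\<theta>\<close> the
  multiples \<open>k * \<theta>\<close> with \<open>k > 0\<close> are dense modulo \<open>1\<close>,
  and \<open>cis\<close> carries this density to the circle.\<close>

lemma circle_powers_near:
  assumes z: "z = cis (2 * pi * \<theta>)" "\<theta> \<notin> \<rat>" and w: "w \<in> unit_circle" and "\<epsilon> > 0"
  shows "\<exists>m>0. dist (z ^ m) w < \<epsilon>"
proof -
  have t: "w = cis (Arg w)"
    using w cis_Arg[of w] by (cases "w = 0") (auto simp: sgn_div_norm)
  define \<alpha> where "\<alpha> = Arg w / (2 * pi)"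
  have w': "w = cis (2 * pi * \<alpha>)" using t by (simp add: \<alpha>_def)
  have "isCont (\<lambda>x. cis (2 * pi * x)) \<alpha>"
    unfolding cis_conv_exp by (intro continuous_intros)
  then obtain \<delta> where \<delta>: "\<delta> > 0" "\<And>x. dist x \<alpha> < \<delta> \<Longrightarrow> dist (cis (2 * pi * x)) w < \<epsilon>"
    unfolding w' continuous_at_eps_delta using \<open>\<epsilon> > 0\<close> by blast
  obtain h k where hk: "k > 0" "\<bar>of_int k * \<theta> - of_int h - \<alpha>\<bar> < \<delta>"
    using sequence_of_fractional_parts_is_dense[OF z(2) \<delta>(1)] by metis
  have "z ^ nat k = cis (2 * pi * (of_int k * \<theta>))"
    using hk(1) by (simp add: z(1) Complex.DeMoivre mult_ac)
  also have "\<dots> = cis (2 * pi * (of_int k * \<theta> - of_int h) + 2 * pi * of_int h)"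
    by (simp add: algebra_simps)
  also have "\<dots> = cis (2 * pi * (of_int k * \<theta> - of_int h))"
    unfolding cis_mult[symmetric] by (simp add: cis_multiple_2pi)
  finally show ?thesis using \<delta>(2)[of "of_int k * \<theta> - of_int h"] hk
    by (intro exI[of _ "nat k"]) (auto simp: dist_real_def)
qed

section \<open>Images under power maps\<close>

lemma measurable_power_circle: "(\<lambda>z. z ^ m) \<in> measurable circle_borel circle_borel"
  by (intro measurable_restrict_space3) (auto simp: norm_power)

lemma distr_power_prob_circle:
  assumes "\<mu> \<in> prob_circle"
  shows "distr \<mu> circle_borel (\<lambda>z. z ^ m) \<in> prob_circle"
proof -
  interpret prob_space \<mu> using prob_circleD[OF assms] by simp
  show ?thesis unfolding prob_circle_def
    using measurable_power_circle by (auto simp: measurable_prob_circle_iff[OF assms] intro!: prob_space_distr)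
qed

text \<open>On the circle, \<open>u = z powi j\<close> satisfies
  \<open>|u ^ m - 1| \<le> m * |u - 1|\<close>, so the power map enlarges deviations at most by the
  fixed factor \<open>m\<close>.\<close>

lemma distr_power_rigid:
  assumes "\<mu> \<in> rigid_measures n"
  shows "distr \<mu> circle_borel (\<lambda>z. z ^ m) \<in> rigid_measures n" 
proof -
  have \<mu>: "\<mu> \<in> prob_circle" using assms by (simp add: rigid_measures_def)
  note [measurable_cong] = prob_circleD(2)[OF \<mu>]
  have le: "power_deviation (distr \<mu> circle_borel (\<lambda>z. z ^ m)) j \<le> of_nat m * power_deviation \<mu> j" for j
  proof -
    have "power_deviation (distr \<mu> circle_borel (\<lambda>z. z ^ m)) j
        = (\<integral>\<^sup>+ z. ennreal (norm ((z ^ m) powi j - 1)) \<partial>\<mu>)"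
      unfolding power_deviation_def using measurable_power_circle
      by (intro nn_integral_distr) (auto simp: measurable_prob_circle_iff[OF \<mu>])
    also have "\<dots> \<le> (\<integral>\<^sup>+ z. of_nat m * ennreal (norm (z powi j - 1)) \<partial>\<mu>)"
    proof (rule nn_integral_mono)
      fix z assume "z \<in> space \<mu>"
      then have z: "norm z = 1" by (simp add: prob_circleD(3)[OF \<mu>])
      have "norm ((z powi j) ^ m - 1 ^ m) \<le> m * norm (z powi j - 1)"
        by (rule norm_power_diff) (simp_all add: norm_power_int z)
      moreover have "(z ^ m) powi j = (z powi j) ^ m"
        by (metis power_int_mult power_int_of_nat mult.commute)
      ultimately have "norm ((z ^ m) powi j - 1) \<le> m * norm (z powi j - 1)" by simp
      then show "ennreal (norm ((z ^ m) powi j - 1)) \<le> of_nat m * ennreal (norm (z powi j - 1))"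
        by (simp add: ennreal_of_nat_eq_real_of_nat flip: ennreal_mult)
    qed
    also have "\<dots> = of_nat m * power_deviation \<mu> j"
      unfolding power_deviation_def by (rule nn_integral_cmult) measurable
    finally show ?thesis .
  qed
  have "(\<lambda>k. of_nat m * power_deviation \<mu> (n k)) \<longlonglongrightarrow> of_nat m * 0"
    using assms \<mu> by (intro tendsto_mult_ennreal tendsto_const)
      (auto simp: rigid_measures_iff_power_deviation)
  then have "(\<lambda>k. power_deviation (distr \<mu> circle_borel (\<lambda>z. z ^ m)) (n k)) \<longlonglongrightarrow> 0"
    by (intro tendsto_0_ennreal_mono[OF _ le]) simp
  then show ?thesis
    by (simp add: rigid_measures_iff_power_deviation distr_power_prob_circle \<mu>)
qed

lemma emeasure_countable_eq_0:
  assumes "\<mu> \<in> cont_prob_circle" "countable A" "A \<subseteq> unit_circle"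
  shows "emeasure \<mu> A = 0"
proof -
  have \<mu>: "\<mu> \<in> prob_circle" "\<And>z. z \<in> unit_circle \<Longrightarrow> emeasure \<mu> {z} = 0"
    using assms by (auto simp: cont_prob_circle_iff)
  have "emeasure \<mu> A = (\<integral>\<^sup>+ z. emeasure \<mu> {z} \<partial>count_space A)"
    using assms singleton_sets_circle prob_circleD(2)[OF \<mu>(1)]
    by (intro emeasure_countable_singleton) auto
  also have "\<dots> = (\<integral>\<^sup>+ z. 0 \<partial>count_space A)"
    by (rule nn_integral_cong) (use assms \<mu> in auto)
  finally show ?thesis by simp
qed

text \<open>For \<open>m > 0\<close> every fibre of the power map is a finite set of roots, which a
  continuous measure does not charge.\<close>

lemma distr_power_continuous:
  assumes "\<mu> \<in> cont_prob_circle" "m > 0"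
  shows "distr \<mu> circle_borel (\<lambda>z. z ^ m) \<in> cont_prob_circle" 
proof -
  have \<mu>: "\<mu> \<in> prob_circle" using assms by (auto simp: cont_prob_circle_iff)
  have "emeasure (distr \<mu> circle_borel (\<lambda>z. z ^ m)) {w} = 0" if "w \<in> unit_circle" for w
  proof -
    have "emeasure (distr \<mu> circle_borel (\<lambda>z. z ^ m)) {w} = emeasure \<mu> {z \<in> unit_circle. z ^ m = w}"
      using measurable_power_circle singleton_sets_circle[OF that]
      by (subst emeasure_distr)
        (auto simp: measurable_prob_circle_iff[OF \<mu>] prob_circleD(3)[OF \<mu>] intro!: arg_cong[of _ _ "emeasure \<mu>"])
    also have "\<dots> = 0"
      by (rule emeasure_countable_eq_0[OF assms(1) countable_finite])
        (auto intro!: finite_subset[OF _ finite_nth_roots[OF assms(2), of w]])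
    finally show ?thesis .
  qed
  then show ?thesis using distr_power_prob_circle[OF \<mu>] by (simp add: cont_prob_circle_iff)
qed

text \<open>Off the countable set of roots of unity, every \<open>z\<close> has a power close to \<open>w\<close>; hence some
  fixed exponent \<open>m\<close> works on a set of positive measure.\<close>
lemma rigid_continuous_near_point:
  assumes \<mu>: "\<mu> \<in> rigid_measures n" "\<mu> \<in> cont_prob_circle" and w: "w \<in> unit_circle" and "\<epsilon> > 0"
  shows "\<exists>\<nu> \<in> rigid_measures n \<inter> cont_prob_circle. AE z in \<nu>. dist z w < \<epsilon>"
proof -
  have pc: "\<mu> \<in> prob_circle" using \<mu> by (auto simp: cont_prob_circle_iff)
  interpret prob_space \<mu> using prob_circleD[OF pc] by simp
  note [measurable_cong] = prob_circleD(2)[OF pc]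
  define Q where "Q = (\<lambda>\<theta>::real. cis (2 * pi * \<theta>)) ` \<rat>"
  define B where "B m = {z \<in> unit_circle. dist (z ^ m) w < \<epsilon>}" for m
  have B: "B m \<in> sets \<mu>" for m
    unfolding B_def prob_circleD(2)[OF pc] by (rule sets_circle_pred) measurable
  have Q: "emeasure \<mu> Q = 0"
    unfolding Q_def by (intro emeasure_countable_eq_0[OF \<mu>(2)] countable_image countable_rat) auto
  have Qs: "Q \<in> sets \<mu>"
  proof -
    have "Q \<in> sets borel"
      by (rule sets.countable) (simp_all add: Q_def countable_rat)
    moreover have "Q \<subseteq> unit_circle" by (auto simp: Q_def)
    ultimately show ?thesis by (simp add: prob_circleD(2)[OF pc] sets_restrict_space_iff)
  qed
  have "\<exists>m>0. emeasure \<mu> (B m) \<noteq> 0"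
  proof (rule ccontr)
    assume "\<not> ?thesis"
    \<comment> \<open>The shift to \<open>Suc m\<close> excludes the exponent \<open>0\<close>,
      whose power map would collapse the measure to the point mass at \<open>1\<close>.\<close>
    then have "(\<Union>m. B (Suc m)) \<in> null_sets \<mu>"
      using B by (intro null_sets_UN) auto
    then have "Q \<union> (\<Union>m. B (Suc m)) \<in> null_sets \<mu>" using Q Qs by auto
    moreover have "unit_circle \<subseteq> Q \<union> (\<Union>m. B (Suc m))"
    proof
      fix z :: complex assume z: "z \<in> unit_circle"
      obtain \<theta> where \<theta>: "z = cis (2 * pi * \<theta>)"
      proof
        show "z = cis (2 * pi * (Arg z / (2 * pi)))"
          using z cis_Arg[of z] by (cases "z = 0") (auto simp: sgn_div_norm)
      qed
      show "z \<in> Q \<union> (\<Union>m. B (Suc m))"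
      proof (cases "\<theta> \<in> \<rat>")
        case False
        then obtain m where "m > 0" "dist (z ^ m) w < \<epsilon>"
          using circle_powers_near[OF \<theta> False w \<open>\<epsilon> > 0\<close>] by blast
        then show ?thesis using z by (cases m) (auto simp: B_def)
      qed (auto simp: Q_def \<theta>)
    qed
    ultimately have "space \<mu> \<in> null_sets \<mu>"
      using prob_circleD(3)[OF pc] null_sets_subset by (metis sets.top)
    then show False using emeasure_space_1 by auto
  qed
  then obtain m where m: "m > 0" "emeasure \<mu> (B m) \<noteq> 0" by blast
  define \<nu> where "\<nu> = uniform_measure \<mu> (B m)"
  have \<nu>: "\<nu> \<in> rigid_measures n" "\<nu> \<in> cont_prob_circle"
    unfolding \<nu>_def using m \<mu> by (auto intro: uniform_measure_rigid uniform_measure_continuous)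
  then have \<nu>pc: "\<nu> \<in> prob_circle" by (simp add: rigid_measures_def)
  have "AE z in \<nu>. dist (z ^ m) w < \<epsilon>"
    unfolding \<nu>_def by (rule AE_uniform_measureI[OF B]) (auto simp: B_def)
  moreover have "{z \<in> space circle_borel. dist z w < \<epsilon>} \<in> sets circle_borel"
    using sets_circle_pred[of "\<lambda>z. dist z w < \<epsilon>"] by (simp add: space_restrict_space)
  ultimately have "AE z in distr \<nu> circle_borel (\<lambda>z. z ^ m). dist z w < \<epsilon>"
    using measurable_power_circle by (subst AE_distr_iff) (auto simp: measurable_prob_circle_iff[OF \<nu>pc])
  then show ?thesis using distr_power_rigid[OF \<nu>(1)] distr_power_continuous[OF \<nu>(2) m(1)] by blast
qed

section \<open>Integrals of continuous functions on the circle\<close>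

lemma continuous_circle_bounded:
  fixes f :: "complex \<Rightarrow> real"
  assumes "continuous_on unit_circle f"
  obtains C where "C \<ge> 0" "\<And>z. z \<in> unit_circle \<Longrightarrow> \<bar>f z\<bar> \<le> C"
proof -
  have "bounded (f ` unit_circle)"
    by (intro compact_imp_bounded compact_continuous_image assms) simp
  then obtain C where "C > 0" "\<forall>x\<in>f ` unit_circle. norm x \<le> C"
    unfolding bounded_pos by blast
  then show ?thesis by (intro that[of C]) auto
qed

lemma integrable_continuous_circle:
  fixes f :: "complex \<Rightarrow> real"
  assumes "continuous_on unit_circle f" "\<mu> \<in> prob_circle"
  shows "integrable \<mu> f"
proof -
  interpret prob_space \<mu> using prob_circleD[OF assms(2)] by simp
  obtain C where C: "\<And>z. z \<in> unit_circle \<Longrightarrow> \<bar>f z\<bar> \<le> C"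
    using continuous_circle_bounded[OF assms(1)] by metis
  have [measurable]: "f \<in> borel_measurable \<mu>"
    using borel_measurable_continuous_on_restrict[OF assms(1)] 
    by (simp add: measurable_prob_circle_iff[OF assms(2)])
  show ?thesis
    by (rule integrable_const_bound[where B=C])
      (use C in \<open>auto simp: prob_circleD(3)[OF assms(2)] intro!: AE_I2\<close>)
qed

lemma integral_bind_circle:
  fixes f :: "complex \<Rightarrow> real"
  assumes f: "continuous_on unit_circle f" and "prob_space \<sigma>"
    and \<kappa>: "\<kappa> \<in> measurable \<sigma> (prob_algebra circle_borel)"
  shows "(LINT z|(\<sigma> \<bind> \<kappa>). f z) = (LINT x|\<sigma>. LINT z|\<kappa> x. f z)"
proof -
  interpret prob_space \<sigma> by fact
  obtain C where C: "\<And>z. z \<in> unit_circle \<Longrightarrow> \<bar>f z\<bar> \<le> C"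
    using continuous_circle_bounded[OF f] by metis
  have "AE x in \<sigma>. emeasure (\<kappa> x) (space (\<kappa> x)) \<le> ennreal 1"
    using measurable_space[OF \<kappa>] by (auto simp: space_prob_algebra prob_space.emeasure_space_1)
  then show ?thesis
    using C measurable_prob_algebraD[OF \<kappa>] borel_measurable_continuous_on_restrict[OF f] finite_measure_axioms
    by (intro integral_bind[where K=circle_borel and B=C and B'=1])
      (auto simp: space_restrict_space)
qed

lemma limitin_imp_in_closure_of:
  assumes "limitin X s l sequentially" "\<And>i. s i \<in> S"
  shows "l \<in> X closure_of S"
  using assms unfolding limitin_sequentially in_closure_of by blast

text \<open>Each measure in the approximating sequence replaces the point mass at \<open>z\<close> in \<open>\<sigma>\<close> by a rigid
  continuous measure supported near \<open>z\<close>, the choice depending only on the first term of a dense sequence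
  that is close to \<open>z\<close>, which makes it measurable.\<close>
lemma weakly_dense_rigid_continuous:
  assumes "rigidity_sequence n"
  shows "weakly_dense (rigid_measures n \<inter> cont_prob_circle)"
proof -
  define S where "S = rigid_measures n \<inter> cont_prob_circle"
  have Spc: "S \<subseteq> prob_circle" by (auto simp: S_def rigid_measures_def)
  obtain \<mu> where \<mu>: "\<mu> \<in> rigid_measures n" "\<mu> \<in> cont_prob_circle"
    using assms by (auto simp: rigidity_sequence_def rigid_measures_def cont_prob_circle_def)
  obtain D :: "complex set" where D: "countable D" "D \<subseteq> unit_circle" "unit_circle \<subseteq> closure D"
    using separable by blast
  have Dne: "D \<noteq> {}" 
  proof
    assume "D = {}"
    moreover have "(1::complex) \<in> unit_circle" by simp
    ultimately show False using D by auto
  qed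
  define d where "d = from_nat_into D"
  have dr: "range d = D" unfolding d_def by (rule range_from_nat_into[OF Dne D(1)])
  then have dT: "d i \<in> unit_circle" for i using D(2) by blast
  define e where "e j = inverse (real (Suc j))" for j
  have e: "e j > 0" for j by (simp add: e_def)
  have "\<forall>j i. \<exists>\<nu>\<in>S. AE z in \<nu>. dist z (d i) < e j"
    unfolding S_def using rigid_continuous_near_point[OF \<mu> dT e] by blast
  then obtain \<nu> where \<nu>: "\<And>j i. \<nu> j i \<in> S" "\<And>j i. AE z in \<nu> j i. dist z (d i) < e j"
    by metis
  have \<nu>pc: "\<nu> j i \<in> prob_circle" for i j using \<nu>(1) Spc by blast
  define c where "c j z = (LEAST i. dist z (d i) < e j)" for j z
  have c: "dist z (d (c j z)) < e j" if zT: "z \<in> unit_circle" for j z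
  proof -
    obtain x where "x \<in> D" "dist x z < e j"
      using D(3) zT e[of j] closure_approachable[of z D] by blast
    then obtain i where "dist z (d i) < e j" using dr by (metis rangeE dist_commute)
    then show ?thesis unfolding c_def by (rule LeastI)
  qed
  have "\<sigma> \<in> weak_topology closure_of S" if \<sigma>: "\<sigma> \<in> prob_circle" for \<sigma>
  proof -
    interpret prob_space \<sigma> using prob_circleD[OF \<sigma>] by simp
    define \<kappa> where "\<kappa> j z = \<nu> j (c j z)" for j z
    have \<kappa>[measurable]: "\<kappa> j \<in> measurable \<sigma> (prob_algebra circle_borel)" for j
    proof -
      have "\<nu> j \<in> measurable (count_space UNIV) (prob_algebra circle_borel)"
        using \<nu>pc by (simp add: prob_circle_eq)
      moreover have "c j \<in> measurable circle_borel (count_space UNIV)"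
        unfolding c_def by (rule measurable_restrict_space1) measurable
      then have "c j \<in> measurable \<sigma> (count_space UNIV)"
        by (simp add: measurable_prob_circle_iff[OF \<sigma>])
      ultimately show ?thesis unfolding \<kappa>_def by (rule measurable_compose[rotated])
    qed
    define M where "M j = \<sigma> \<bind> \<kappa> j" for j
    have Mpc: "M j \<in> prob_circle" for j
      unfolding M_def by (rule bind_prob_circle[OF prob_space_axioms \<kappa>])
    have "M j \<in> rigid_measures n" for j
    proof -
      \<comment> \<open>Convergence need not be uniform over the components of the mixture;
        pointwise convergence suffices because deviations never exceed \<open>2\<close>.\<close>
      have "(\<lambda>k. power_deviation (M j) (n k)) \<longlonglongrightarrow> (\<integral>\<^sup>+ z. 0 \<partial>\<sigma>)"
        unfolding M_def power_deviation_bind[OF \<kappa>]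
      proof (rule nn_integral_dominated_convergence[where w="\<lambda>_. 2"])
        show "(\<lambda>z. power_deviation (\<kappa> j z) (n k)) \<in> borel_measurable \<sigma>" for k
          unfolding power_deviation_def
          by (rule measurable_compose[OF measurable_prob_algebraD[OF \<kappa>] nn_integral_measurable_subprob_algebra])
            measurable
        show "AE z in \<sigma>. (\<lambda>k. power_deviation (\<kappa> j z) (n k)) \<longlonglongrightarrow> 0"
          using \<nu>(1) \<nu>pc by (simp add: \<kappa>_def S_def flip: rigid_measures_iff_power_deviation)
      qed (auto simp: \<kappa>_def \<nu>pc power_deviation_le_2 emeasure_space_1)
      then show ?thesis using Mpc by (simp add: rigid_measures_iff_power_deviation)
    qed
    moreover have "M j \<in> cont_prob_circle" for j
      using \<nu>(1) Mpc unfolding cont_prob_circle_iff M_def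
      by (auto simp: emeasure_bind_singleton[OF prob_space_axioms \<kappa>] \<kappa>_def S_def cont_prob_circle_iff
            intro!: nn_integral_zero')
    ultimately have MS: "M j \<in> S" for j by (simp add: S_def)
    have "limitin weak_topology M \<sigma> sequentially"
      unfolding limitin_weak_topology_iff[OF Mpc \<sigma>]
    proof (intro allI impI)
      fix f :: "complex \<Rightarrow> real" assume f: "continuous_on unit_circle f"
      show "(\<lambda>j. LINT z|M j. f z) \<longlonglongrightarrow> (LINT z|\<sigma>. f z)"
      proof (rule LIMSEQ_I)
        fix r :: real assume r: "r > 0"
        have "uniformly_continuous_on unit_circle f"
          by (rule compact_uniformly_continuous[OF f]) simp
        then obtain s where s: "s > 0"
          "\<And>x y. x \<in> unit_circle \<Longrightarrow> y \<in> unit_circle \<Longrightarrow> dist y x < s \<Longrightarrow> dist (f y) (f x) < r / 2"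
          unfolding uniformly_continuous_on_def using r by (metis half_gt_zero)
        obtain j0 where j0: "e j0 < s / 2" using reals_Archimedean[of "s / 2"] s(1) by (auto simp: e_def)
        have "norm ((LINT z|M j. f z) - (LINT z|\<sigma>. f z)) < r" if "j \<ge> j0" for j
        proof -
          have "e j \<le> e j0" unfolding e_def by (rule le_imp_inverse_le) (use that in auto)
          then have ej: "e j < s / 2" using j0 by simp
          \<comment> \<open>The measure \<open>\<kappa> j x\<close> lives within \<open>e j\<close>
            of \<open>d (c j x)\<close>, which is itself within \<open>e j\<close> of
            \<open>x\<close>. Hence it lives within \<open>s\<close> of \<open>x\<close>, where
            \<open>f\<close> differs from \<open>f x\<close> by less than
            \<open>r / 2\<close>.\<close>
          have loc: "\<bar>(LINT z|\<kappa> j x. f z) - f x\<bar> \<le> r / 2" if x: "x \<in> unit_circle" for x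
          proof -
            have pc: "\<kappa> j x \<in> prob_circle" by (simp add: \<kappa>_def \<nu>pc)
            interpret K: prob_space "\<kappa> j x" using prob_circleD[OF pc] by simp
            have int: "integrable (\<kappa> j x) f" by (rule integrable_continuous_circle[OF f pc])
            have "AE z in \<kappa> j x. z \<in> unit_circle" using prob_circleD(3)[OF pc] by (metis AE_space)
            moreover have "AE z in \<kappa> j x. dist z (d (c j x)) < e j" unfolding \<kappa>_def by (rule \<nu>(2))
            ultimately have "AE z in \<kappa> j x. \<bar>f z - f x\<bar> \<le> r / 2"
            proof eventually_elim
              case (elim z)
              have "dist z x < s"
                using dist_triangle2[of z x "d (c j x)"] elim(2) c[OF x, of j] ej by simp
              then have "dist (f z) (f x) < r / 2" using s(2)[OF x elim(1)] by simp
              then show ?case by (simp add: dist_real_def)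
            qed
            then have bd: "AE z in \<kappa> j x. f z \<le> f x + r / 2" "AE z in \<kappa> j x. f x - r / 2 \<le> f z"
              by (eventually_elim, linarith)+
            then show ?thesis
              using K.integral_le_const[OF int bd(1)] K.integral_ge_const[OF int bd(2)] by linarith
          qed
          have intk: "integrable \<sigma> (\<lambda>x. LINT z|\<kappa> j x. f z)"
          proof -
            obtain C where C: "\<And>z. z \<in> unit_circle \<Longrightarrow> \<bar>f z\<bar> \<le> C"
              using continuous_circle_bounded[OF f] by metis
            have "norm (LINT z|\<kappa> j x. f z) \<le> C + r / 2" if "x \<in> unit_circle" for x
              using loc[OF that] C[OF that] unfolding real_norm_def by linarith
            moreover have "(\<lambda>x. LINT z|\<kappa> j x. f z) \<in> borel_measurable \<sigma>"
              using borel_measurable_continuous_on_restrict[OF f]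
              by (intro measurable_compose[OF measurable_prob_algebraD[OF \<kappa>] integral_measurable_subprob_algebra])
            ultimately show ?thesis
              by (intro integrable_const_bound[where B="C + r / 2"]) (auto simp: prob_circleD(3)[OF \<sigma>])
          qed
          have intf: "integrable \<sigma> f" by (rule integrable_continuous_circle[OF f \<sigma>])
          have "(LINT z|M j. f z) - (LINT z|\<sigma>. f z) = (LINT x|\<sigma>. (LINT z|\<kappa> j x. f z) - f x)"
            unfolding M_def integral_bind_circle[OF f prob_space_axioms \<kappa>] using intk intf by simp
          also have "norm \<dots> \<le> (LINT x|\<sigma>. norm ((LINT z|\<kappa> j x. f z) - f x))"
            by (rule integral_norm_bound)
          also have "\<dots> \<le> r / 2"
            using loc prob_circleD(3)[OF \<sigma>] intk intf by (intro integral_le_const) auto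
          finally show ?thesis using r by simp
        qed
        then show "\<exists>no. \<forall>j\<ge>no. norm ((LINT z|M j. f z) - (LINT z|\<sigma>. f z)) < r" by blast
      qed
    qed
    then show ?thesis using MS by (rule limitin_imp_in_closure_of)
  qed
  then have "weak_topology closure_of S = prob_circle"
    using closure_of_subset_topspace[of weak_topology S] by auto
  then show ?thesis by (simp add: weakly_dense_def S_def)
qed

section \<open>From density to a continuous rigid measure\<close>

text \<open>The tent function \<open>f\<close> has positive integral against the point mass at
  \<open>w\<close>, so \<open>W\<close> is a weak neighbourhood of that point mass. A rigid measure
  in \<open>W\<close> must charge the \<open>\<epsilon>\<close>-disc around \<open>w\<close>, and
  its normalised restriction to this disc is still rigid.\<close>

lemma dense_rigid_near_point:
  assumes dense: "weakly_dense (rigid_measures n)" and w: "w \<in> unit_circle" and "\<epsilon> > 0"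
  shows "\<exists>\<nu>\<in>rigid_measures n. AE z in \<nu>. dist z w < \<epsilon>"
proof -
  define f where "f z = max 0 (\<epsilon> - dist z w)" for z
  define W where "W = {\<mu> \<in> prob_circle. (LINT z|\<mu>. f z) \<in> {0<..}}"
  have f: "continuous_on unit_circle f" unfolding f_def by (intro continuous_intros)
  have "openin weak_topology W"
    unfolding weak_topology_def W_def
    by (rule topology_generated_by_Basis, rule CollectI, rule exI[of _ f], rule exI[of _ "{0<..}"])
      (use f in simp)
  moreover have wsp: "w \<in> space circle_borel" using w by (simp add: space_restrict_space)
  have pc: "return circle_borel w \<in> prob_circle"
    using wsp by (simp add: prob_circle_def prob_space_return)
  have "return circle_borel w \<in> W"
    using integral_return[OF wsp borel_measurable_continuous_on_restrict[OF f]] pc \<open>\<epsilon> > 0\<close>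
    by (simp add: W_def f_def)
  ultimately obtain \<mu> where \<mu>: "\<mu> \<in> rigid_measures n" "\<mu> \<in> W"
    using dense pc unfolding weakly_dense_def by (metis in_closure_of)
  have \<mu>pc: "\<mu> \<in> prob_circle" using \<mu> by (simp add: W_def)
  define B where "B = {z \<in> unit_circle. dist z w < \<epsilon>}"
  have B: "B \<in> sets \<mu>"
    unfolding B_def prob_circleD(2)[OF \<mu>pc] by (rule sets_circle_pred) measurable
  have "emeasure \<mu> B \<noteq> 0"
  proof
    assume "emeasure \<mu> B = 0"
    then have "AE z in \<mu>. z \<notin> B" using B by (intro AE_not_in) auto
    moreover have "AE z in \<mu>. z \<in> unit_circle" using prob_circleD(3)[OF \<mu>pc] by (metis AE_space)
    ultimately have "AE z in \<mu>. f z = 0" by eventually_elim (auto simp: B_def f_def)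
    then have "(LINT z|\<mu>. f z) = 0" by (rule integral_eq_zero_AE)
    then show False using \<mu> by (simp add: W_def)
  qed
  then have "uniform_measure \<mu> B \<in> rigid_measures n" by (rule uniform_measure_rigid[OF \<mu>(1)])
  moreover have "AE z in uniform_measure \<mu> B. dist z w < \<epsilon>"
    by (rule AE_uniform_measureI[OF B]) (auto simp: B_def)
  ultimately show ?thesis by blast
qed

text \<open>A small disc around a point \<open>w \<noteq> 1\<close> close to \<open>1\<close> stays
  away from \<open>1\<close>. The inner radius \<open>s'\<close> leaves room to place further
  measures still closer to \<open>1\<close> with disjoint supports.\<close>

lemma dense_rigid_near_1:
  assumes "weakly_dense (rigid_measures n)" "s > 0"
  shows "\<exists>s' \<nu>. 0 < s' \<and> s' < s \<and> \<nu> \<in> rigid_measures n \<and> (AE z in \<nu>. s' < dist z 1 \<and> dist z 1 < s)"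
proof -
  have "(1::complex) islimpt unit_circle"
  proof (rule connected_imp_perfect)
    show "unit_circle \<noteq> {x}" for x :: complex
    proof
      assume "unit_circle = {x}"
      moreover have "1 \<in> unit_circle" "-1 \<in> unit_circle" by auto
      ultimately have "(1::complex) = -1" by (metis singletonD)
      then show False by simp
    qed
  qed (auto intro: connected_sphere)
  then obtain w :: complex where w: "w \<in> unit_circle" "w \<noteq> 1" "dist w 1 < s"
    unfolding islimpt_approachable using assms(2) by blast
  \<comment> \<open>Half the smaller of the gaps from \<open>w\<close> to \<open>1\<close> and from
    \<open>w\<close> to the outer edge of the annulus. It serves both as the radius of the disc
    around \<open>w\<close> and as the inner radius \<open>s'\<close>.\<close>
  define r where "r = min (dist w 1) (s - dist w 1) / 2"
  have r: "r > 0" "2 * r \<le> dist w 1" "2 * r \<le> s - dist w 1" using w by (auto simp: r_def)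
  obtain \<nu> where \<nu>: "\<nu> \<in> rigid_measures n" "AE z in \<nu>. dist z w < r"
    using dense_rigid_near_point[OF assms(1) w(1) r(1)] by blast
  have "AE z in \<nu>. r < dist z 1 \<and> dist z 1 < s"
    using \<nu>(2)
  proof eventually_elim
    case (elim z)
    then show ?case
      using dist_triangle[of w 1 z] dist_triangle[of z 1 w] r by (simp add: dist_commute)
  qed
  moreover have "r < s" using r by linarith
  ultimately show ?thesis using \<nu>(1) r(1) by blast
qed

text \<open>Each power is continuous at \<open>1\<close>, and a common radius exists because only
  finitely many exponents are involved. This controls the deviations at early indices.\<close>

lemma powi_near_1:
  assumes "\<epsilon> > 0"
  shows "\<exists>s>0. \<forall>k<(K::nat). \<forall>z\<in>unit_circle. z \<noteq> 1 \<and> dist z 1 < s \<longrightarrow> norm (z powi (n k :: int) - 1) < \<epsilon>"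
proof -
  have "\<forall>\<^sub>F z in at (1::complex) within unit_circle. norm (z powi m - 1) < \<epsilon>" for m
  proof -
    have "((\<lambda>z::complex. z powi m) \<longlongrightarrow> 1 powi m) (at 1 within unit_circle)"
      using continuous_on_powi_circle[of m] unfolding continuous_on_def by (rule bspec) simp
    from tendstoD[OF this assms] show ?thesis by (simp add: dist_norm)
  qed
  then have "\<forall>\<^sub>F z in at (1::complex) within unit_circle. \<forall>k\<in>{..<K}. norm (z powi n k - 1) < \<epsilon>"
    by (intro eventually_ball_finite) auto
  then show ?thesis unfolding eventually_at by fastforce
qed

lemma measurable_count_prob_circle:
  "(\<And>i. \<nu> i \<in> prob_circle) \<Longrightarrow> \<nu> \<in> measurable (count_space UNIV) (prob_algebra circle_borel)"
  by (simp add: prob_circle_eq)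

lemma emeasure_singleton_eq_0_AE:
  assumes "\<mu> \<in> prob_circle" "z \<in> unit_circle" "AE x in \<mu>. P x" "\<not> P z"
  shows "emeasure \<mu> {z} = 0"
proof -
  have "AE x in \<mu>. \<not> x = z" using assms(3) by eventually_elim (use assms(4) in auto)
  then have "emeasure \<mu> {x \<in> space \<mu>. x = z} = 0" by (rule emeasure_eq_0_AE)
  moreover have "{x \<in> space \<mu>. x = z} = {z}" using assms(2) prob_circleD(3)[OF assms(1)] by auto
  ultimately show ?thesis by simp
qed

text \<open>Each term is at most \<open>b * indicator A l + c\<close>, and \<open>b\<close> is paid
  at most once. It is applied to atoms and to deviations, where at most one of the averaged measures
  is bad.\<close>

lemma sum_le_card_plus:
  fixes f :: "nat \<Rightarrow> ennreal"
  assumes "\<And>l. f l \<le> b" "\<And>l. l \<notin> A \<Longrightarrow> f l \<le> c" "\<And>l l'. l \<in> A \<Longrightarrow> l' \<in> A \<Longrightarrow> l = l'"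
  shows "sum f {..<L} \<le> b + of_nat L * c"
proof -
  have "sum f {..<L} \<le> (\<Sum>l<L. b * indicator A l + c)"
    by (intro sum_mono) (use assms(1,2) in \<open>auto simp: indicator_def intro: add_increasing2\<close>)
  also have "\<dots> = b * (\<Sum>l<L. indicator A l) + of_nat L * c"
    by (simp add: sum.distrib sum_distrib_left)
  also have "(\<Sum>l<L. indicator A l :: ennreal) \<le> 1"
  proof -
    have "(\<Sum>l<L. indicator A l :: ennreal) = of_nat (card ({..<L} \<inter> A))"
      by (simp add: indicator_def sum.If_cases)
    moreover have "card ({..<L} \<inter> A) \<le> Suc 0"
      using assms(3) by (subst card_le_Suc0_iff_eq) auto
    ultimately show ?thesis by (metis One_nat_def of_nat_1 of_nat_mono)
  qed
  finally show ?thesis by (simp add: mult_left_mono add_mono)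
qed

text \<open>The measures \<open>\<nu>\<^sub>l\<close> are chosen successively, each so close to \<open>1\<close> that its deviation is small up
  to the index where that of its predecessor has become small for good. Then for every \<open>k\<close> at
  most one of the \<open>L\<close> averaged measures has a large deviation at \<open>n\<^sub>k\<close>, and their disjoint supports keep
  the atoms of the average small.\<close>
lemma rigid_small_atoms_uniform_deviation:
  assumes dense: "weakly_dense (rigid_measures n)" and "\<delta> > 0" and "L > 0"
  shows "\<exists>\<nu>\<in>rigid_measures n. (AE z in \<nu>. dist z 1 < \<delta>) \<and>
    (\<forall>z\<in>unit_circle. emeasure \<nu> {z} \<le> ennreal (1 / real L)) \<and>
    (\<forall>k. power_deviation \<nu> (n k) \<le> ennreal (3 / real L))"
proof -
  \<comment> \<open>A state holds a measure, an index \<open>K\<close> and a radius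
    \<open>s\<close>. In every state after the first, the measure lives outside radius
    \<open>s\<close> and has small deviation from \<open>K\<close> on; its successor lives inside
    radius \<open>s\<close> and has small deviation before \<open>K\<close>.\<close>
  define P where "P = (\<lambda>(_::nat) (\<nu>::complex measure, K::nat, s::real). 0 < s \<and> s \<le> \<delta>)"
  define Q where "Q = (\<lambda>(_::nat) (\<nu>::complex measure, K::nat, s::real) (\<nu>', K', s').
    \<nu>' \<in> rigid_measures n \<and> K \<le> K' \<and> s' \<le> s \<and> (AE z in \<nu>'. s' < dist z 1 \<and> dist z 1 < s) \<and>
    (\<forall>k. k < K \<or> K' \<le> k \<longrightarrow> power_deviation \<nu>' (n k) \<le> ennreal (1 / real L)))"
  have "\<exists>f. \<forall>l. P l (f l) \<and> Q l (f l) (f (Suc l))"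
  proof (rule dependent_nat_choice)
    \<comment> \<open>The measure here is a placeholder: the averaged measures are taken from the
      states \<open>f (Suc l)\<close>.\<close>
    show "\<exists>x. P 0 x" by (rule exI[of _ "(undefined, 0, \<delta>)"]) (simp add: P_def \<open>\<delta> > 0\<close>)
    fix x l assume Px: "P l x"
    obtain \<nu> K s where x: "x = (\<nu>, K, s)" by (cases x)
    have s: "0 < s" "s \<le> \<delta>" using Px by (auto simp: P_def x)
    have L1: "1 / real L > 0" using \<open>L > 0\<close> by simp
    obtain s0 where s0: "s0 > 0"
      "\<And>k z. k < K \<Longrightarrow> z \<in> unit_circle \<Longrightarrow> z \<noteq> 1 \<Longrightarrow> dist z 1 < s0 \<Longrightarrow> norm (z powi n k - 1) < 1 / real L"
      using powi_near_1[OF L1, of K n] by blast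
    obtain s' \<nu>' where \<nu>': "0 < s'" "s' < min s s0" "\<nu>' \<in> rigid_measures n"
      "AE z in \<nu>'. s' < dist z 1 \<and> dist z 1 < min s s0"
      using dense_rigid_near_1[OF dense, of "min s s0"] s s0 by (metis min_less_iff_conj)
    have pc: "\<nu>' \<in> prob_circle" using \<nu>'(3) by (simp add: rigid_measures_def)
    have AEs: "AE z in \<nu>'. z \<in> unit_circle" using prob_circleD(3)[OF pc] by (metis AE_space)
    have early: "power_deviation \<nu>' (n k) \<le> ennreal (1 / real L)" if "k < K" for k
    proof (rule power_deviation_le[OF pc])
      show "AE z in \<nu>'. norm (z powi n k - 1) \<le> 1 / real L"
        using \<nu>'(4) AEs
      proof eventually_elim
        case (elim z)
        then show ?case using s0(2)[OF that, of z] \<nu>'(1) by force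
      qed
    qed
    have "(\<lambda>k. power_deviation \<nu>' (n k)) \<longlonglongrightarrow> 0"
      using \<nu>'(3) by (simp add: rigid_measures_iff_power_deviation[OF pc])
    then have "\<forall>\<^sub>F k in sequentially. power_deviation \<nu>' (n k) < ennreal (1 / real L)"
      by (rule order_tendstoD) (use L1 in simp)
    then obtain K1 where K1: "\<And>k. k \<ge> K1 \<Longrightarrow> power_deviation \<nu>' (n k) < ennreal (1 / real L)"
      unfolding eventually_sequentially by blast
    have "AE z in \<nu>'. s' < dist z 1 \<and> dist z 1 < s" using \<nu>'(4) by eventually_elim auto
    \<comment> \<open>Taking \<open>max K K1\<close> keeps the thresholds monotone, so that the
      index windows on which deviations may be large are disjoint.\<close>
    then have "P (Suc l) (\<nu>', max K K1, s') \<and> Q l x (\<nu>', max K K1, s')"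
      using \<nu>' s early K1 by (auto simp: P_def Q_def x intro: less_imp_le)
    then show "\<exists>y. P (Suc l) y \<and> Q l x y" by blast
  qed
  then obtain f where f: "\<And>l. P l (f l)" "\<And>l. Q l (f l) (f (Suc l))" by blast
  define \<nu> where "\<nu> l = fst (f (Suc l))" for l
  define K where "K l = fst (snd (f l))" for l
  define s where "s l = snd (snd (f l))" for l
  have s\<delta>: "s l \<le> \<delta>" for l
    using f(1)[of l] by (simp add: P_def s_def split_beta)
  have Q: "\<nu> l \<in> rigid_measures n" "K l \<le> K (Suc l)" "s (Suc l) \<le> s l"
     "AE z in \<nu> l. s (Suc l) < dist z 1 \<and> dist z 1 < s l"
     "\<And>k. k < K l \<or> K (Suc l) \<le> k \<Longrightarrow> power_deviation (\<nu> l) (n k) \<le> ennreal (1 / real L)" for l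
    using f(2)[of l] unfolding Q_def s_def K_def \<nu>_def split_beta by blast+
  have monoK: "K l \<le> K l'" if "l \<le> l'" for l l' using lift_Suc_mono_le[of K, OF Q(2) that] .
  have antis: "s l' \<le> s l" if "l \<le> l'" for l l' using lift_Suc_antimono_le[of s, OF Q(3) that] .
  have pc: "\<nu> l \<in> prob_circle" for l using Q(1) by (auto simp: rigid_measures_def)
  have kern: "\<nu> \<in> measurable (measure_pmf (pmf_of_set {..<L})) (prob_algebra circle_borel)"
    using measurable_count_prob_circle[OF pc] by (simp cong: measurable_cong_sets)
  define M where "M = measure_pmf (pmf_of_set {..<L}) \<bind> \<nu>"
  have Mpc: "M \<in> prob_circle"
    unfolding M_def by (rule bind_prob_circle[OF measure_pmf.prob_space_axioms kern])
  have avg: "(\<integral>\<^sup>+ l. g l \<partial>measure_pmf (pmf_of_set {..<L})) = sum g {..<L} / of_nat L" for g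
    using \<open>L > 0\<close> by (subst nn_integral_pmf_of_set) (auto simp: ennreal_of_nat_eq_real_of_nat)
  have dev: "power_deviation M m = (\<Sum>l<L. power_deviation (\<nu> l) m) / of_nat L" for m
    unfolding M_def power_deviation_bind[OF kern] avg ..
  have "M \<in> rigid_measures n"
  proof -
    have "(\<lambda>k. \<Sum>l<L. power_deviation (\<nu> l) (n k)) \<longlonglongrightarrow> (\<Sum>l<L. 0)"
      using Q(1) pc by (intro tendsto_sum) (simp add: rigid_measures_iff_power_deviation)
    then have "(\<lambda>k. power_deviation M (n k)) \<longlonglongrightarrow> (\<Sum>l<L. 0) / of_nat L"
      unfolding dev divide_ennreal_def using \<open>L > 0\<close>
      by (intro tendsto_mult_ennreal tendsto_const) (auto simp: ennreal_inverse_eq_top_iff)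
    then show ?thesis using Mpc by (simp add: rigid_measures_iff_power_deviation)
  qed
  moreover have "AE z in M. dist z 1 < \<delta>"
  proof -
    have "AE z in \<nu> l. dist z 1 < \<delta>" for l
      using Q(4)[of l] by eventually_elim (use s\<delta>[of l] in auto)
    moreover have "Measurable.pred circle_borel (\<lambda>z. dist z 1 < \<delta>)"
      by (rule measurable_restrict_space1) measurable
    ultimately show ?thesis
      unfolding M_def by (subst AE_bind[OF measurable_prob_algebraD[OF kern]]) auto
  qed
  moreover have "emeasure M {z} \<le> ennreal (1 / real L)" if z: "z \<in> unit_circle" for z
  proof -
    \<comment> \<open>The annuli carrying the \<open>\<nu> l\<close> are disjoint because
      \<open>s\<close> decreases, so \<open>z\<close> can be an atom of at most one of them.\<close>
    define A where "A = {l. s (Suc l) < dist z 1 \<and> dist z 1 < s l}"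
    have "sum (\<lambda>l. emeasure (\<nu> l) {z}) {..<L} \<le> 1 + of_nat L * 0"
    proof (rule sum_le_card_plus[where A=A])
      show "emeasure (\<nu> l) {z} \<le> 1" for l
        using prob_circleD(1)[OF pc[of l]] by (rule prob_space.emeasure_le_1)
      show "emeasure (\<nu> l) {z} \<le> 0" if "l \<notin> A" for l
        using emeasure_singleton_eq_0_AE[OF pc z Q(4)] that by (simp add: A_def)
      show "l = l'" if "l \<in> A" "l' \<in> A" for l l'
        using that antis[of "Suc l" l'] antis[of "Suc l'" l]
        by (cases l l' rule: linorder_cases) (auto simp: A_def)
    qed
    then have "emeasure M {z} \<le> 1 / of_nat L"
      unfolding M_def emeasure_bind_singleton[OF measure_pmf.prob_space_axioms kern z] avg
      by (intro divide_right_mono_ennreal) simp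
    also have "\<dots> = ennreal (1 / real L)"
      using \<open>L > 0\<close> by (simp add: ennreal_of_nat_eq_real_of_nat divide_ennreal flip: ennreal_1)
    finally show ?thesis .
  qed
  moreover have "power_deviation M (n k) \<le> ennreal (3 / real L)" for k
  proof -
    \<comment> \<open>Here \<open>A\<close> collects those \<open>l\<close> whose window from
      \<open>K l\<close> to \<open>K (Suc l)\<close> contains \<open>k\<close>. The windows are
      disjoint, so only one term can be as large as \<open>2\<close>; the others add up to at most
      \<open>1\<close>, whence the constant \<open>3\<close>.\<close>
    define A where "A = {l. K l \<le> k \<and> k < K (Suc l)}"
    have "(\<Sum>l<L. power_deviation (\<nu> l) (n k)) \<le> 2 + of_nat L * ennreal (1 / real L)"
    proof (rule sum_le_card_plus[where A=A])
      show "power_deviation (\<nu> l) (n k) \<le> 2" for l by (rule power_deviation_le_2[OF pc])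
      show "power_deviation (\<nu> l) (n k) \<le> ennreal (1 / real L)" if "l \<notin> A" for l
        using that by (intro Q(5)) (auto simp: A_def)
      show "l = l'" if "l \<in> A" "l' \<in> A" for l l'
        using that monoK[of "Suc l" l'] monoK[of "Suc l'" l]
        by (cases l l' rule: linorder_cases) (auto simp: A_def)
    qed
    also have "2 + of_nat L * ennreal (1 / real L) = ennreal 3"
      using \<open>L > 0\<close> by (simp add: ennreal_of_nat_eq_real_of_nat flip: ennreal_mult ennreal_numeral ennreal_plus ennreal_1)
    finally have "power_deviation M (n k) \<le> ennreal 3 / of_nat L"
      unfolding dev by (intro divide_right_mono_ennreal)
    also have "\<dots> = ennreal (3 / real L)"
      using \<open>L > 0\<close> by (simp add: ennreal_of_nat_eq_real_of_nat divide_ennreal del: ennreal_numeral)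
    finally show ?thesis .
  qed
  ultimately show ?thesis by blast
qed

section \<open>Infinite products of points of the circle\<close>

text \<open>Powers are multiplicative, and for factors of modulus \<open>1\<close> the distance of a
  product from \<open>1\<close> is at most the sum of the distances of the factors. This makes
  deviations subadditive under convolution.\<close>

lemma norm_prod_powi_diff_1:
  fixes \<omega> :: "nat \<Rightarrow> complex"
  assumes "\<And>i. norm (\<omega> i) = 1"
  shows "norm ((\<Prod>i<N. \<omega> i) powi m - 1) \<le> (\<Sum>i<N. norm (\<omega> i powi m - 1))"
proof -
  have "(\<Prod>i<N. \<omega> i) powi m = (\<Prod>i<N. \<omega> i powi m)"
    by (induction N) (auto simp: power_int_mult_distrib)
  then show ?thesis
    using norm_prod_diff[of "{..<N}" "\<lambda>i. \<omega> i powi m" "\<lambda>_. 1"] assms by (simp add: norm_power_int)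
qed

text \<open>Partial products have modulus \<open>1\<close>, so the increment at \<open>N\<close> has
  the modulus of \<open>\<omega> N - 1\<close> and the increments are dominated by a geometric
  series.\<close>

lemma Cauchy_prod_near_1:
  fixes \<omega> :: "nat \<Rightarrow> complex"
  assumes "\<And>i. norm (\<omega> i) = 1" "\<And>i. dist (\<omega> i) 1 < (1/2) ^ i"
  shows "Cauchy (\<lambda>N. \<Prod>i<N. \<omega> i)"
proof -
  define p where "p N = (\<Prod>i<N. \<omega> i)" for N
  have "norm (p (Suc N) - p N) \<le> (1/2) ^ N" for N
  proof -
    have "p (Suc N) - p N = p N * (\<omega> N - 1)" by (simp add: p_def algebra_simps)
    moreover have "norm (p N) = 1" using assms(1) by (simp add: p_def prod_norm[symmetric])
    ultimately show ?thesis using assms(2)[of N] by (simp add: norm_mult dist_norm)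
  qed
  then have "summable (\<lambda>N. p (Suc N) - p N)"
    by (intro summable_comparison_test'[OF summable_geometric[of "1/2 :: real"], of 0]) simp_all
  then have "convergent (\<lambda>N. p N - p 0)"
    by (simp add: summable_iff_convergent sum_lessThan_telescope)
  then have "convergent (\<lambda>N. (p N - p 0) + p 0)" by (intro convergent_add convergent_const)
  then show ?thesis by (simp add: p_def Cauchy_convergent_iff)
qed

text \<open>The infinite convolution of the \<open>\<nu> j\<close> is the law of the product of independent random
  variables with these laws. Its largest atom is at most that of each factor, and deviations add up.\<close>
lemma rigidity_sequence_infinite_convolution:
  assumes R: "\<And>j. \<nu> j \<in> rigid_measures n"
    and near: "\<And>j. AE z in \<nu> j. dist z 1 < (1/2) ^ j"
    and atoms: "\<And>j z. z \<in> unit_circle \<Longrightarrow> emeasure (\<nu> j) {z} \<le> ennreal ((1/2) ^ j)"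
    and dev: "\<And>j k. power_deviation (\<nu> j) (n k) \<le> ennreal ((1/2) ^ j)"
  shows "rigidity_sequence n"
proof -
  have pc: "\<nu> j \<in> prob_circle" for j using R by (auto simp: rigid_measures_def)
  note prob = prob_circleD(1)[OF pc] and setsv[measurable_cong] = prob_circleD(2)[OF pc]
    and spacev = prob_circleD(3)[OF pc]
  define P where "P = PiM UNIV \<nu>"
  interpret P: prob_space P unfolding P_def by (rule prob_space_PiM) (rule prob)
  have spaceP: "\<omega> \<in> space P \<Longrightarrow> norm (\<omega> i) = 1" for \<omega> i
    by (auto simp: P_def space_PiM spacev PiE_iff)
  have comp: "(\<lambda>\<omega>. \<omega> j) \<in> measurable P (\<nu> j)" for j
    unfolding P_def by (rule measurable_component_singleton) simp
  have comp_borel[measurable]: "(\<lambda>\<omega>. \<omega> j) \<in> borel_measurable P" for j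
  proof -
    have "(\<lambda>z. z) \<in> borel_measurable (\<nu> j)"
      by (simp add: measurable_prob_circle_iff[OF pc] measurable_restrict_space1)
    from measurable_compose[OF comp this] show ?thesis .
  qed
  define p where "p \<omega> N = (\<Prod>i<N. \<omega> i)" for \<omega> :: "nat \<Rightarrow> complex" and N
  \<comment> \<open>The default \<open>1\<close> keeps \<open>Z\<close> on the circle even where the
    product diverges, so that \<open>Z\<close> maps measurably into
    \<open>circle_borel\<close>.\<close>
  define Z where "Z \<omega> = (if Cauchy (p \<omega>) then lim (p \<omega>) else 1)" for \<omega>
  have pmeas[measurable]: "(\<lambda>\<omega>. p \<omega> N) \<in> borel_measurable P" for N
    unfolding p_def by measurable
  have Cmeas: "{\<omega> \<in> space P. Cauchy (p \<omega>)} \<in> sets P"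
    using sets_Collect_Cauchy[of "\<lambda>N \<omega>. p \<omega> N" P] by simp
  have ZB: "Z \<in> borel_measurable P"
    unfolding Z_def
    by (rule measurable_If[OF _ _ Cmeas]) (use borel_measurable_lim_metric[of "\<lambda>N \<omega>. p \<omega> N" P] in simp_all)
  have Zlim: "p \<omega> \<longlonglongrightarrow> Z \<omega>" if "Cauchy (p \<omega>)" for \<omega>
    using that by (simp add: Z_def Cauchy_convergent_iff convergent_LIMSEQ_iff)
  have Znorm: "norm (Z \<omega>) = 1" if "\<omega> \<in> space P" for \<omega>
  proof (cases "Cauchy (p \<omega>)")
    case True
    have "norm (p \<omega> N) = 1" for N using spaceP[OF that] by (simp add: p_def prod_norm[symmetric])
    then show ?thesis using tendsto_norm[OF Zlim[OF True]] by (simp add: LIMSEQ_const_iff)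
  qed (simp add: Z_def)
  have ZM: "Z \<in> measurable P circle_borel"
    using ZB Znorm by (intro measurable_restrict_space2) auto
  have Cauchy: "AE \<omega> in P. Cauchy (p \<omega>)"
  proof -
    have "AE \<omega> in P. \<forall>j. dist (\<omega> j) 1 < (1/2) ^ j"
      unfolding P_def AE_all_countable by (intro allI AE_PiM_component prob near) simp
    with AE_space show ?thesis
    proof eventually_elim
      case (elim \<omega>)
      then show ?case unfolding p_def using spaceP by (intro Cauchy_prod_near_1) auto
    qed
  qed
  define \<mu> where "\<mu> = distr P circle_borel Z"
  have \<mu>pc: "\<mu> \<in> prob_circle"
    unfolding \<mu>_def prob_circle_def using P.prob_space_distr[OF ZM] by simp

  \<comment> \<open>The bound for finite products passes to the limit almost surely. Exchanging sum
    and integral then leaves the deviations of the coordinate laws \<open>\<nu> j\<close>.\<close>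
  have devle: "power_deviation \<mu> m \<le> (\<Sum>j. power_deviation (\<nu> j) m)" for m
  proof -
    have pm: "(\<lambda>\<omega>. \<omega> j powi m) \<in> borel_measurable P" for j
      using measurable_compose[OF comp[of j], of "\<lambda>z. z powi m" borel] measurable_powi_circle by (simp add: measurable_prob_circle_iff[OF pc])
    have "power_deviation \<mu> m = (\<integral>\<^sup>+ \<omega>. ennreal (norm (Z \<omega> powi m - 1)) \<partial>P)"
      unfolding power_deviation_def \<mu>_def by (rule nn_integral_distr[OF ZM]) measurable
    also have "\<dots> \<le> (\<integral>\<^sup>+ \<omega>. (\<Sum>j. ennreal (norm (\<omega> j powi m - 1))) \<partial>P)"
    proof (rule nn_integral_mono_AE)
      show "AE \<omega> in P. ennreal (norm (Z \<omega> powi m - 1)) \<le> (\<Sum>j. ennreal (norm (\<omega> j powi m - 1)))"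
        using Cauchy AE_space
      proof eventually_elim
        case (elim \<omega>)
        have "Z \<omega> \<noteq> 0" using Znorm[OF elim(2)] by auto
        then have "(\<lambda>N. ennreal (norm (p \<omega> N powi m - 1))) \<longlonglongrightarrow> ennreal (norm (Z \<omega> powi m - 1))"
          using Zlim[OF elim(1)] by (intro tendsto_ennrealI tendsto_intros) auto
        moreover have "ennreal (norm (p \<omega> N powi m - 1)) \<le> (\<Sum>j. ennreal (norm (\<omega> j powi m - 1)))" for N
        proof -
          have "ennreal (norm (p \<omega> N powi m - 1)) \<le> ennreal (\<Sum>j<N. norm (\<omega> j powi m - 1))"
            unfolding p_def using spaceP[OF elim(2)] by (intro ennreal_leI norm_prod_powi_diff_1)
          also have "\<dots> = (\<Sum>j<N. ennreal (norm (\<omega> j powi m - 1)))" by (simp add: sum_ennreal)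
          also have "\<dots> \<le> (\<Sum>j. ennreal (norm (\<omega> j powi m - 1)))" by (rule sum_le_suminf) auto
          finally show ?thesis .
        qed
        ultimately show ?case by (meson LIMSEQ_le_const2)
      qed
    qed
    also have "\<dots> = (\<Sum>j. \<integral>\<^sup>+ \<omega>. ennreal (norm (\<omega> j powi m - 1)) \<partial>P)"
      by (rule nn_integral_suminf) (use pm in measurable)
    also have "\<dots> = (\<Sum>j. power_deviation (\<nu> j) m)"
    proof (rule arg_cong[where f=suminf], rule ext)
      fix j
      have "power_deviation (\<nu> j) m = power_deviation (distr P (\<nu> j) (\<lambda>\<omega>. \<omega> j)) m"
        unfolding P_def by (subst distr_PiM_component) (auto simp: prob)
      also have "\<dots> = (\<integral>\<^sup>+ \<omega>. ennreal (norm (\<omega> j powi m - 1)) \<partial>P)"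
        unfolding power_deviation_def by (rule nn_integral_distr[OF comp]) measurable
      finally show "(\<integral>\<^sup>+ \<omega>. ennreal (norm (\<omega> j powi m - 1)) \<partial>P) = power_deviation (\<nu> j) m" ..
    qed
    finally show ?thesis .
  qed
  have "(\<lambda>k. \<Sum>j. power_deviation (\<nu> j) (n k)) \<longlonglongrightarrow> 0"
  proof -
    \<comment> \<open>Tannery's theorem as dominated convergence for counting measure: each term
      tends to \<open>0\<close>, and the bound \<open>(1/2) ^ j\<close>, uniform in
      \<open>k\<close>, is summable.\<close>
    have "(\<lambda>k. \<integral>\<^sup>+ j. power_deviation (\<nu> j) (n k) \<partial>count_space UNIV) \<longlonglongrightarrow> (\<integral>\<^sup>+ (j::nat). 0 \<partial>count_space UNIV)"
    proof (rule nn_integral_dominated_convergence[where w="\<lambda>j. ennreal ((1/2) ^ j)"])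
      have "(\<integral>\<^sup>+ j. ennreal ((1/2) ^ j) \<partial>count_space UNIV) = (\<Sum>j. ennreal ((1/2) ^ j))"
        by (rule nn_integral_count_space_nat)
      also have "\<dots> = ennreal (\<Sum>j. (1/2) ^ j)"
        by (rule suminf_ennreal2) (simp_all add: summable_geometric)
      finally show "(\<integral>\<^sup>+ j. ennreal ((1/2) ^ j) \<partial>count_space UNIV) < \<infinity>" by simp
      show "AE j in count_space UNIV. (\<lambda>k. power_deviation (\<nu> j) (n k)) \<longlonglongrightarrow> 0"
        using R rigid_measures_iff_power_deviation[OF pc] by auto
    qed (auto simp: dev)
    then show ?thesis by (simp add: nn_integral_count_space_nat)
  qed
  then have "(\<lambda>k. power_deviation \<mu> (n k)) \<longlonglongrightarrow> 0" by (rule tendsto_0_ennreal_mono[OF _ devle])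
  then have \<mu>R: "\<mu> \<in> rigid_measures n" by (simp add: rigid_measures_iff_power_deviation[OF \<mu>pc])

  \<comment> \<open>Once all coordinates other than \<open>j\<close> are fixed, at most one value of
    coordinate \<open>j\<close> makes the product converge to \<open>x\<close>. The conditional
    probability is thus at most the largest atom of \<open>\<nu> j\<close>.\<close>
  have atom: "emeasure \<mu> {x} \<le> ennreal ((1/2) ^ j)" if x: "x \<in> unit_circle" for x j
  proof -
    define I where "I = PiM (UNIV - {j}) \<nu>"
    interpret I: prob_space I unfolding I_def by (rule prob_space_PiM) (rule prob)
    interpret N: prob_space "\<nu> j" by (rule prob)
    interpret pair_sigma_finite "\<nu> j" I ..
    \<comment> \<open>Requiring \<open>Cauchy (p \<omega>)\<close> removes the points where
      \<open>Z\<close> takes its default value, so that on \<open>A\<close> the partial products do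
      converge to \<open>x\<close>.\<close>
    define A where "A = {\<omega> \<in> space P. Z \<omega> = x \<and> Cauchy (p \<omega>)}"
    have A: "A \<in> sets P"
    proof -
      have "Z -` {x} \<inter> space P \<in> sets P" by (rule measurable_sets[OF ZB]) simp
      moreover have "A = (Z -` {x} \<inter> space P) \<inter> {\<omega> \<in> space P. Cauchy (p \<omega>)}"
        unfolding A_def by blast
      ultimately show ?thesis using sets.Int[OF _ Cmeas] by simp
    qed
    have ins: "(\<lambda>(t, X). X(j := t)) \<in> measurable (\<nu> j \<Otimes>\<^sub>M I) P"
    proof -
      have "(\<lambda>(t, X). X(j := t)) \<in> measurable (\<nu> j \<Otimes>\<^sub>M I) (PiM (insert j (UNIV - {j})) \<nu>)"
        unfolding I_def split_beta by (rule measurable_fun_upd[where J="UNIV - {j}"]) (auto intro: measurable_fst measurable_snd)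
      then show ?thesis by (simp add: P_def)
    qed
    \<comment> \<open>Coordinate \<open>j\<close> is independent of the others: drawing it
      separately and inserting it reproduces \<open>P\<close>.\<close>
    have Peq: "P = distr (\<nu> j \<Otimes>\<^sub>M I) P (\<lambda>(t, X). X(j := t))"
      using distr_pair_PiM_eq_PiM[of "UNIV - {j}" \<nu> j, OF prob prob] unfolding P_def I_def
      by simp
    have "emeasure \<mu> {x} = emeasure P (Z -` {x} \<inter> space P)"
      unfolding \<mu>_def by (rule emeasure_distr[OF ZM singleton_sets_circle[OF x]])
    also have "\<dots> = emeasure P A"
    proof (rule emeasure_eq_AE)
      show "AE \<omega> in P. \<omega> \<in> Z -` {x} \<inter> space P \<longleftrightarrow> \<omega> \<in> A"
        using Cauchy by eventually_elim (auto simp: A_def)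
      show "Z -` {x} \<inter> space P \<in> sets P" by (rule measurable_sets[OF ZB]) simp
    qed (rule A)
    also have "\<dots> = emeasure (distr (\<nu> j \<Otimes>\<^sub>M I) P (\<lambda>(t, X). X(j := t))) A"
      by (rule arg_cong[OF Peq, of "\<lambda>M. emeasure M A"])
    also have "\<dots>
        = emeasure (\<nu> j \<Otimes>\<^sub>M I) ((\<lambda>(t, X). X(j := t)) -` A \<inter> space (\<nu> j \<Otimes>\<^sub>M I))"
      by (rule emeasure_distr[OF ins A])
    also have "\<dots> = (\<integral>\<^sup>+ X. emeasure (\<nu> j) ((\<lambda>t. (t, X)) -` ((\<lambda>(t, X). X(j := t)) -` A \<inter> space (\<nu> j \<Otimes>\<^sub>M I))) \<partial>I)"
      by (rule emeasure_pair_measure_alt2[OF measurable_sets[OF ins A]])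
    also have "\<dots> \<le> (\<integral>\<^sup>+ X. ennreal ((1/2) ^ j) \<partial>I)"
    proof (rule nn_integral_mono)
      fix X 
      define B where "B = (\<lambda>t. (t, X)) -` ((\<lambda>(t, X). X(j := t)) -` A \<inter> space (\<nu> j \<Otimes>\<^sub>M I))"
      have BT: "B \<subseteq> unit_circle" by (auto simp: B_def space_pair_measure spacev)
      \<comment> \<open>Beyond index \<open>j\<close>, the partial products for \<open>t\<close> and
        \<open>t'\<close> differ only in the factor at \<open>j\<close>. Cross-multiplying and
        passing to the limit gives \<open>t' * x = t * x\<close> with \<open>x\<close>
        nonzero.\<close>
      have uniq: "t = t'" if "t \<in> B" "t' \<in> B" for t t'
      proof -
        have lim: "p (X(j := u)) \<longlonglongrightarrow> x" if "u \<in> B" for u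
          using that Zlim[of "X(j := u)"] by (auto simp: B_def A_def)
        have split: "p (X(j := u)) N = u * (\<Prod>i\<in>{..<N} - {j}. X i)" if "N > j" for u N
          unfolding p_def using that by (subst prod.remove[of _ j]) (auto intro!: prod.cong)
        have ev: "\<forall>\<^sub>F N in sequentially. t' * p (X(j := t)) N = t * p (X(j := t')) N"
          using eventually_gt_at_top[of j] by eventually_elim (simp add: split)
        have lims: "(\<lambda>N. t' * p (X(j := t)) N) \<longlonglongrightarrow> t' * x" "(\<lambda>N. t * p (X(j := t')) N) \<longlonglongrightarrow> t * x"
          using lim that by (auto intro!: tendsto_mult_left)
        have "t' * x = t * x"
          by (rule LIMSEQ_unique[OF Lim_transform_eventually[OF lims(1) ev] lims(2)])
        moreover have "x \<noteq> 0" using x by auto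
        ultimately show ?thesis by simp
      qed
      show "emeasure (\<nu> j) B \<le> ennreal ((1/2) ^ j)"
      proof (cases "B = {}")
        case False
        then obtain t where "B = {t}" using uniq by blast
        then show ?thesis using atoms BT by auto
      qed simp
    qed
    also have "\<dots> = ennreal ((1/2) ^ j)" by (simp add: I.emeasure_space_1)
    finally show ?thesis .
  qed
  have "emeasure \<mu> {x} = 0" if "x \<in> unit_circle" for x
  proof -
    have "(\<lambda>j. ennreal ((1/2) ^ j)) \<longlonglongrightarrow> ennreal 0"
      by (intro tendsto_ennrealI LIMSEQ_realpow_zero) auto
    then have "emeasure \<mu> {x} \<le> ennreal 0"
      by (rule LIMSEQ_le_const) (use atom[OF that] in blast)
    then show ?thesis by simp
  qed
  then have "\<mu> \<in> cont_prob_circle" using \<mu>pc by (simp add: cont_prob_circle_iff)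
  then show ?thesis using \<mu>R by (auto simp: rigidity_sequence_def rigid_measures_def)
qed

lemma rigidity_sequence_if_dense:
  assumes "weakly_dense (rigid_measures n)"
  shows "rigidity_sequence n"
proof -
  have "\<exists>\<nu>\<in>rigid_measures n. (AE z in \<nu>. dist z 1 < (1/2) ^ j) \<and>
    (\<forall>z\<in>unit_circle. emeasure \<nu> {z} \<le> ennreal ((1/2) ^ j)) \<and>
    (\<forall>k. power_deviation \<nu> (n k) \<le> ennreal ((1/2) ^ j))" for j :: nat
  proof -
    \<comment> \<open>The factor \<open>3\<close> cancels the constant in the deviation bound
      \<open>3 / L\<close>, leaving exactly \<open>(1/2) ^ j\<close>.\<close>
    define L :: nat where "L = 3 * 2 ^ j"
    obtain \<nu> where "\<nu> \<in> rigid_measures n" "AE z in \<nu>. dist z 1 < (1/2) ^ j"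
      "\<forall>z\<in>unit_circle. emeasure \<nu> {z} \<le> ennreal (1 / real L)"
      "\<forall>k. power_deviation \<nu> (n k) \<le> ennreal (3 / real L)"
      using rigid_small_atoms_uniform_deviation[OF assms, of "(1/2) ^ j" L] by (auto simp: L_def)
    moreover have "ennreal (1 / real L) \<le> ennreal ((1/2) ^ j)"
      by (rule ennreal_leI) (simp add: L_def field_simps)
    moreover have "ennreal (3 / real L) = ennreal ((1/2) ^ j)"
      by (simp add: L_def power_one_over)
    ultimately show ?thesis by (metis order_trans)
  qed
  then obtain \<nu> where "\<And>j. \<nu> j \<in> rigid_measures n" "\<And>j. AE z in \<nu> j. dist z 1 < (1/2) ^ j"
    "\<And>j z. z \<in> unit_circle \<Longrightarrow> emeasure (\<nu> j) {z} \<le> ennreal ((1/2) ^ j)"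
    "\<And>j k. power_deviation (\<nu> j) (n k) \<le> ennreal ((1/2) ^ j)"
    by metis
  then show ?thesis by (rule rigidity_sequence_infinite_convolution)
qed

lemma weakly_dense_mono:
  assumes "weakly_dense A" "A \<subseteq> B"
  shows "weakly_dense B"
  using assms closure_of_mono[of A B weak_topology] closure_of_subset_topspace[of weak_topology B]
  by (auto simp: weakly_dense_def)

theorem theorem4p1:
  fixes n :: "nat \<Rightarrow> int"
  shows "(rigidity_sequence n \<longleftrightarrow> weakly_dense (rigid_measures n)) \<and>
    (rigidity_sequence n \<longrightarrow> weakly_dense (rigid_measures n \<inter> cont_prob_circle))"
  using weakly_dense_rigid_continuous[of n] rigidity_sequence_if_dense[of n]
    weakly_dense_mono[of "rigid_measures n \<inter> cont_prob_circle" "rigid_measures n"] by blast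

end
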